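(* Let $P,S,\gamma,\beta$ be operators as in the context satisfying the Unbounded operator, Symmetry, Maximality and Density assumptions listed there, and let $$\mathcal{L}:=\begin{bmatrix}P\\ \gamma\\ S\\ \beta\end{bmatrix}\mathcal{Z}_1=\{(Pz,\gamma z,Sz,\beta z): z\in\mathcal{Z}_1\}\subset\mathcal{X}\times\mathcal{Y}\times\mathcal{E}\times\mathcal{U}$$ be the associated Stokes-Lagrange structure. Then $\mathcal{L}$ equals its orthogonal with respect to the augmented minus product: $$\mathcal{L}=\mathcal{L}^{\perp\!\!\!\perp_-}.$$ That is, a Stokes-Lagrange structure is a Lagrange structure.
   Context: $\mathcal{Z}$ (containing the latent space), $\mathcal{X}$ (state space) and $\mathcal{U}$ (control space) are real Hilbert spaces; $\mathcal{E}:=\mathcal{X}'$ (effort space) and $\mathcal{Y}:=\mathcal{U}'$ (observation space) are the duals, with duality pairings $\langle\cdot,\cdot\rangle_{\mathcal{E},\mathcal{X}}$ and $\langle\cdot,\cdot\rangle_{\mathcal{U},\mathcal{Y}}$. $P:\mathcal{D}(P)\subset\mathcal{Z}\to\mathcal{X}$ and $S:\mathcal{D}(S)\subset\mathcal{Z}\to\mathcal{E}$ are linear operators. Unbounded operator assumption: one of $P,S$ is bounded on $\mathcal{Z}$ and the other is densely defined and closed; $\mathcal{Z}_1$ denotes the domain of the latter ($\mathcal{Z}_1=\mathcal{D}(P)$ or $\mathcal{Z}_1=\mathcal{D}(S)$ accordingly). $\gamma:\mathcal{Z}_1\to\mathcal{Y}$ and $\beta:\mathcal{Z}_1\to\mathcal{U}$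 are linear operators (boundary observation and control), and $\mathcal{Z}_0:=\ker(\gamma)\cap\ker(\beta)\subset\mathcal{Z}_1$. Symmetry assumption: for all $z_1,z_2\in\mathcal{Z}_1$, $$\langle\beta z_1,\gamma z_2\rangle_{\mathcal{U},\mathcal{Y}}+\langle Sz_1,Pz_2\rangle_{\mathcal{E},\mathcal{X}}=\langle Sz_2,Pz_1\rangle_{\mathcal{E},\mathcal{X}}+\langle\beta z_2,\gamma z_1\rangle_{\mathcal{U},\mathcal{Y}}.$$ Maximality assumption: if $(x,e)\in\mathcal{X}\times\mathcal{E}$ satisfies $\langle Sz,x\rangle_{\mathcal{E},\mathcal{X}}-\langle e,Pz\rangle_{\mathcal{E},\mathcal{X}}=0$ for all $z\in\mathcal{Z}_0$, then there exists $\tilde z\in\mathcal{Z}_1$ with $x=P\tilde z$ and $e=S\tilde z$. Density assumption: the range of $\begin{bmatrix}\gamma\\ \beta\end{bmatrix}:\mathcal{Z}_1\to\mathcal{Y}\times\mathcal{U}$ is dense in $\mathcal{Y}\times\mathcal{U}$. The augmented minus product on $\mathcal{X}\times\mathcal{Y}\times\mathcal{E}\times\mathcal{U}$ is $$\langle\langle(x_1,\chi_1,e_1,\varepsilon_1),(x_2,\chi_2,e_2,\varepsilon_2)\rangle\rangle_-=\langle e_2,x_1\rangle_{\mathcal{E},\mathcal{X}}-\langle e_1,x_2\rangle_{\mathcal{E},\mathcal{X}}+\langle\varepsilon_2,\chi_1\rangle_{\mathcal{U},\mathcal{Y}}-\langle\varepsilon_1,\chi_2\rangle_{\mathcal{U},\mathcal{Y}},$$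 and for a subspace $\mathcal{Q}$, $\mathcal{Q}^{\perp\!\!\!\perp_-}:=\{w:\ \langle\langle w,\tilde w\rangle\rangle_-=0\ \ \forall\tilde w\in\mathcal{Q}\}$. A subspace equal to its own orthogonal with respect to the minus product is called a Lagrange structure (Lagrangian subspace). *)

theory Defs
  imports "HOL-Analysis.Analysis"
begin

text \<open>
  A partially defined operator is a total function together with a domain set; its values outside
  that set are irrelevant. The dual of a space \<open>'x\<close> is \<open>'x \<Rightarrow>\<^sub>L real\<close>, so
  with effort space \<open>'x \<Rightarrow>\<^sub>L real\<close> and observation space \<open>'u \<Rightarrow>\<^sub>L real\<close> the pairing of
  \<open>e\<close> with \<open>x\<close> is \<open>blinfun_apply e x\<close> and the pairing of a control \<open>u\<close> with an
  observation \<open>y\<close> is \<open>blinfun_apply y u\<close>.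
\<close>

definition linear_operator_on ::
    "'a::real_vector set \<Rightarrow> ('a \<Rightarrow> 'b::real_vector) \<Rightarrow> bool" where
  "linear_operator_on D A \<longleftrightarrow>
     subspace D \<and>
     (\<forall>x\<in>D. \<forall>y\<in>D. A (x + y) = A x + A y) \<and>
     (\<forall>c. \<forall>x\<in>D. A (c *\<^sub>R x) = c *\<^sub>R A x)"

definition everywhere_bounded_operator ::
    "'a::real_normed_vector set \<Rightarrow> ('a \<Rightarrow> 'b::real_normed_vector) \<Rightarrow> bool" where
  "everywhere_bounded_operator D A \<longleftrightarrow> D = UNIV \<and> bounded_linear A"

definition densely_defined :: "'a::topological_space set \<Rightarrow> bool" where
  "densely_defined D \<longleftrightarrow> closure D = UNIV"

definition closed_operator ::
    "'a::topological_space set \<Rightarrow> ('a \<Rightarrow> 'b::topological_space) \<Rightarrow> bool" where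
  "closed_operator D A \<longleftrightarrow> closed {(z, A z) | z. z \<in> D}"

definition unbounded_operator_assumption ::
    "'z::real_normed_vector set \<Rightarrow> ('z \<Rightarrow> 'x::real_normed_vector) \<Rightarrow>
     'z set \<Rightarrow> ('z \<Rightarrow> ('x \<Rightarrow>\<^sub>L real)) \<Rightarrow> 'z set \<Rightarrow> bool" where
  "unbounded_operator_assumption DP P DS S Z1 \<longleftrightarrow>
     (everywhere_bounded_operator DP P \<and> densely_defined DS \<and> closed_operator DS S \<and> Z1 = DS) \<or>
     (everywhere_bounded_operator DS S \<and> densely_defined DP \<and> closed_operator DP P \<and> Z1 = DP)"

definition kernel_on :: "'a set \<Rightarrow> ('a \<Rightarrow> 'b::zero) \<Rightarrow> 'a set" where
  "kernel_on D A = {z \<in> D. A z = 0}"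

definition symmetry_assumption ::
    "'z set \<Rightarrow> ('z \<Rightarrow> 'x::real_normed_vector) \<Rightarrow> ('z \<Rightarrow> ('u::real_normed_vector \<Rightarrow>\<^sub>L real)) \<Rightarrow>
     ('z \<Rightarrow> ('x \<Rightarrow>\<^sub>L real)) \<Rightarrow> ('z \<Rightarrow> 'u) \<Rightarrow> bool" where
  "symmetry_assumption Z1 P \<gamma> S \<beta> \<longleftrightarrow>
     (\<forall>z1\<in>Z1. \<forall>z2\<in>Z1.
        blinfun_apply (\<gamma> z2) (\<beta> z1) + blinfun_apply (S z1) (P z2) =
        blinfun_apply (S z2) (P z1) + blinfun_apply (\<gamma> z1) (\<beta> z2))"

definition maximality_assumption ::
    "'z set \<Rightarrow> ('z \<Rightarrow> 'x::real_normed_vector) \<Rightarrow> ('z \<Rightarrow> ('u::real_normed_vector \<Rightarrow>\<^sub>L real)) \<Rightarrow>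
     ('z \<Rightarrow> ('x \<Rightarrow>\<^sub>L real)) \<Rightarrow> ('z \<Rightarrow> 'u) \<Rightarrow> bool" where
  "maximality_assumption Z1 P \<gamma> S \<beta> \<longleftrightarrow>
     (\<forall>x e. (\<forall>z \<in> kernel_on Z1 \<gamma> \<inter> kernel_on Z1 \<beta>.
               blinfun_apply (S z) x - blinfun_apply e (P z) = 0) \<longrightarrow>
            (\<exists>z\<in>Z1. x = P z \<and> e = S z))"

definition density_assumption ::
    "'z set \<Rightarrow> ('z \<Rightarrow> ('u::real_normed_vector \<Rightarrow>\<^sub>L real)) \<Rightarrow> ('z \<Rightarrow> 'u) \<Rightarrow> bool" where
  "density_assumption Z1 \<gamma> \<beta> \<longleftrightarrow> closure ((\<lambda>z. (\<gamma> z, \<beta> z)) ` Z1) = UNIV"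

type_synonym ('x, 'u) port_space = "'x \<times> ('u \<Rightarrow>\<^sub>L real) \<times> ('x \<Rightarrow>\<^sub>L real) \<times> 'u"

fun minus_product ::
    "('x::real_normed_vector, 'u::real_normed_vector) port_space \<Rightarrow> ('x, 'u) port_space \<Rightarrow> real" where
  "minus_product (x1, \<chi>1, e1, \<epsilon>1) (x2, \<chi>2, e2, \<epsilon>2) =
     blinfun_apply e2 x1 - blinfun_apply e1 x2 + blinfun_apply \<chi>1 \<epsilon>2 - blinfun_apply \<chi>2 \<epsilon>1"

definition minus_orthogonal ::
    "('x::real_normed_vector, 'u::real_normed_vector) port_space set \<Rightarrow> ('x, 'u) port_space set" where
  "minus_orthogonal Q = {w. \<forall>w'\<in>Q. minus_product w w' = 0}"

definition lagrange_structure ::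
    "('x::real_normed_vector, 'u::real_normed_vector) port_space set \<Rightarrow> bool" where
  "lagrange_structure Q \<longleftrightarrow> subspace Q \<and> Q = minus_orthogonal Q"

definition stokes_lagrange_structure ::
    "'z set \<Rightarrow> ('z \<Rightarrow> 'x::real_normed_vector) \<Rightarrow> ('z \<Rightarrow> ('u::real_normed_vector \<Rightarrow>\<^sub>L real)) \<Rightarrow>
     ('z \<Rightarrow> ('x \<Rightarrow>\<^sub>L real)) \<Rightarrow> ('z \<Rightarrow> 'u) \<Rightarrow> ('x, 'u) port_space set" where
  "stokes_lagrange_structure Z1 P \<gamma> S \<beta> = {(P z, \<gamma> z, S z, \<beta> z) | z. z \<in> Z1}"

end

theory Submission
  imports Defs
begin

text \<open>
  The symmetry assumption says exactly that the minus product vanishes between any two elements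
  of the structure, so the structure is contained in its orthogonal.

  For the converse, let \<open>(x, \<eta>, e, \<epsilon>)\<close> be orthogonal to the structure. Testing it
  only against \<open>z\<close> with \<open>\<gamma> z = 0\<close> and \<open>\<beta> z = 0\<close> removes the boundary terms, and maximality
  yields a \<open>z\<close> with \<open>x = P z\<close> and \<open>e = S z\<close>. The element of the structure generated by this
  \<open>z\<close> is orthogonal to the structure too, so the difference \<open>(0, \<eta> - \<gamma> z, 0, \<epsilon> - \<beta> z)\<close> is.
  This remainder pairs with boundary data only, and these are dense; as the pairing between
  controls and observations is continuous and separates points
  (\<open>dense_boundary_data_separates\<close>), the remainder is zero. Hence the tuple belongs to the structure.
\<close>

lemma minus_product_diff_left:
  "minus_product (w1 - w2) w' = minus_product w1 w' - minus_product w2 w'"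
  by (cases w1; cases w2; cases w')
     (simp add: blinfun.diff_left blinfun.diff_right)

lemma minus_product_add_left:
  "minus_product (w1 + w2) w' = minus_product w1 w' + minus_product w2 w'"
  by (cases w1; cases w2; cases w')
     (simp add: blinfun.add_left blinfun.add_right)

lemma minus_product_scaleR_left:
  "minus_product (c *\<^sub>R w) w' = c * minus_product w w'"
  by (cases w; cases w')
     (simp add: blinfun.scaleR_left blinfun.scaleR_right algebra_simps)

lemma subspace_minus_orthogonal: "subspace (minus_orthogonal Q)"
proof -
  have "minus_product 0 w' = 0" for w' :: "('a, 'b) port_space"
    using minus_product_scaleR_left[of 0 0 w'] by simp
  then show ?thesis
    by (auto simp: subspace_def minus_orthogonal_def minus_product_add_left
        minus_product_scaleR_left)
qed

text \<open>
  Both sides of the hypothesis are continuous in \<open>(y, u)\<close>, so the identity extends from the dense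
  set to all pairs. Setting \<open>y = 0\<close> kills \<open>\<eta>\<close>; setting \<open>u = 0\<close> kills \<open>\<epsilon>\<close>, because the inner
  product with \<open>\<epsilon>\<close> is an admissible \<open>y\<close> and gives \<open>\<epsilon> \<bullet> \<epsilon> = 0\<close>.
\<close>

lemma dense_boundary_data_separates:
  fixes \<eta> :: "'u::real_inner \<Rightarrow>\<^sub>L real" and \<epsilon> :: 'u
  assumes dense: "closure B = UNIV"
    and eq: "\<And>y u. (y, u) \<in> B \<Longrightarrow> blinfun_apply \<eta> u = blinfun_apply y \<epsilon>"
  shows "\<eta> = 0" and "\<epsilon> = 0"
proof -
  have "closed {p :: ('u \<Rightarrow>\<^sub>L real) \<times> 'u. blinfun_apply \<eta> (snd p) = blinfun_apply (fst p) \<epsilon>}"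
    by (intro closed_Collect_eq continuous_intros)
  then have "closure B \<subseteq> {p. blinfun_apply \<eta> (snd p) = blinfun_apply (fst p) \<epsilon>}"
    using eq by (intro closure_minimal) auto
  then have all: "blinfun_apply \<eta> u = blinfun_apply y \<epsilon>" for y u
    using dense by (auto dest!: subsetD[where c = "(y, u)"])
  show "\<eta> = 0"
    using all[of _ 0] by (intro blinfun_eqI) simp
  show "\<epsilon> = 0"
    using all[of 0 "blinfun_inner_left \<epsilon>"] by simp
qed

lemma stokes_lagrange_subset_minus_orthogonal:
  assumes "symmetry_assumption Z1 P \<gamma> S \<beta>"
  shows "stokes_lagrange_structure Z1 P \<gamma> S \<beta> \<subseteq>
           minus_orthogonal (stokes_lagrange_structure Z1 P \<gamma> S \<beta>)"
  using assms
  by (fastforce simp: stokes_lagrange_structure_def minus_orthogonal_def symmetry_assumption_def)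

text \<open>
  Maximality recovers the components \<open>x\<close> and \<open>e\<close> of an orthogonal element, density the boundary
  components; symmetry is what allows subtracting the recovered element without leaving the
  orthogonal.
\<close>

lemma minus_orthogonal_subset_stokes_lagrange:
  fixes P :: "'z \<Rightarrow> 'x::real_normed_vector" and \<beta> :: "'z \<Rightarrow> 'u::real_inner"
  assumes sym: "symmetry_assumption Z1 P \<gamma> S \<beta>"
    and maxi: "maximality_assumption Z1 P \<gamma> S \<beta>"
    and dense: "density_assumption Z1 \<gamma> \<beta>"
  shows "minus_orthogonal (stokes_lagrange_structure Z1 P \<gamma> S \<beta>) \<subseteq>
           stokes_lagrange_structure Z1 P \<gamma> S \<beta>"
proof
  let ?L = "stokes_lagrange_structure Z1 P \<gamma> S \<beta>"
  let ?w = "\<lambda>z. (P z, \<gamma> z, S z, \<beta> z)"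
  fix w assume w: "w \<in> minus_orthogonal ?L"
  obtain x \<eta> e \<epsilon> where w_eq: "w = (x, \<eta>, e, \<epsilon>)"
    by (cases w)
  have orth: "minus_product w (?w z) = 0" if "z \<in> Z1" for z
    using w that unfolding minus_orthogonal_def stokes_lagrange_structure_def by blast
  have "blinfun_apply (S z) x - blinfun_apply e (P z) = 0"
    if "z \<in> kernel_on Z1 \<gamma> \<inter> kernel_on Z1 \<beta>" for z
    using orth[of z] that by (simp add: w_eq kernel_on_def)
  then obtain z where z: "z \<in> Z1" and x: "x = P z" and e: "e = S z"
    using maxi unfolding maximality_assumption_def by blast
  have z_orth: "minus_product (?w z) (?w z') = 0" if "z' \<in> Z1" for z'
    using stokes_lagrange_subset_minus_orthogonal[OF sym] z that
    unfolding minus_orthogonal_def stokes_lagrange_structure_def by blast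
  have "minus_product (w - ?w z) (?w z') = 0" if "z' \<in> Z1" for z'
    using orth[OF that] z_orth[OF that] by (simp only: minus_product_diff_left)
  then have remainder: "blinfun_apply (\<eta> - \<gamma> z) u = blinfun_apply y (\<epsilon> - \<beta> z)"
    if "(y, u) \<in> (\<lambda>z. (\<gamma> z, \<beta> z)) ` Z1" for y u
    using that by (auto simp: w_eq x e)
  have "\<eta> - \<gamma> z = 0" "\<epsilon> - \<beta> z = 0"
    using dense_boundary_data_separates[OF dense[unfolded density_assumption_def] remainder]
    by blast+
  then have "w = ?w z"
    by (simp add: w_eq x e)
  then show "w \<in> ?L"
    using z by (auto simp: stokes_lagrange_structure_def)
qed

theorem theorem6:
  fixes P :: "'z::{real_inner, complete_space} \<Rightarrow> 'x::{real_inner, complete_space}"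
    and S :: "'z \<Rightarrow> ('x \<Rightarrow>\<^sub>L real)"
    and \<gamma> :: "'z \<Rightarrow> ('u::{real_inner, complete_space} \<Rightarrow>\<^sub>L real)"
    and \<beta> :: "'z \<Rightarrow> 'u"
    and DP DS Z1 :: "'z set"
  assumes "linear_operator_on DP P"
    and "linear_operator_on DS S"
    and "unbounded_operator_assumption DP P DS S Z1"
    and "linear_operator_on Z1 \<gamma>"
    and "linear_operator_on Z1 \<beta>"
    and "symmetry_assumption Z1 P \<gamma> S \<beta>"
    and "maximality_assumption Z1 P \<gamma> S \<beta>"
    and "density_assumption Z1 \<gamma> \<beta>"
  shows "stokes_lagrange_structure Z1 P \<gamma> S \<beta> =
           minus_orthogonal (stokes_lagrange_structure Z1 P \<gamma> S \<beta>) \<and>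
         lagrange_structure (stokes_lagrange_structure Z1 P \<gamma> S \<beta>)"
proof -
  let ?L = "stokes_lagrange_structure Z1 P \<gamma> S \<beta>"
  have eq: "?L = minus_orthogonal ?L"
    using stokes_lagrange_subset_minus_orthogonal minus_orthogonal_subset_stokes_lagrange assms(6-8)
    by (intro equalityI) blast+
  \<comment> \<open>An orthogonal is always a subspace, hence so is a set that equals its own orthogonal.\<close>
  moreover have "subspace ?L"
    using subspace_minus_orthogonal[of ?L] eq by simp
  ultimately show ?thesis
    unfolding lagrange_structure_def by blast
qed

end
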